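(* Let $\Omega\subset\mathbb{R}^d$ be an open domain, let $f:\overline{\Omega}\to(0,\infty)$ be a Lipschitz continuous (strictly positive) function, and let $\Omega_h\subset\Omega$ be a nonempty bounded mesh cell with characteristic size $h>0$ and closure $\overline{\Omega}_h$. Let $\chi_{LGS}(f)$ be the (logarithmic) gradient-scale indicator and $\chi_{LDR}(f)$ the log-dynamic-ratio indicator of $f$ on the cell $\Omega_h$, i.e. $$\chi_{LGS}(f) = h\,\max_{x\in\overline{\Omega}_h} G_h[\log f](x), \qquad \chi_{LDR}(f) = \log\left(\frac{\max_{x\in\overline{\Omega}_h} f(x)}{\min_{x\in\overline{\Omega}_h} f(x)}\right).$$ Then $$\chi_{LGS}(f) = \chi_{LDR}(f).$$
   Context: For a function $g:\overline{\Omega}_h\to\mathbb{R}$ on the closure of a mesh cell $\Omega_h$ with characteristic size $h>0$ (a fixed positive number associated with the cell), the discrete local gradient magnitude is $$G_h[g](x) := \max_{y\in\overline{\Omega}_h}\frac{|g(x)-g(y)|}{h},\qquad x\in\overline{\Omega}_h,$$ where $|\cdot|$ is the absolute value. Here $\log$ is the natural logarithm. The indicators $\chi_{LGS}$ and $\chi_{LDR}$ depend on the cell $\Omega_h$, which is suppressed in the notation. *)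

theory Defs
  imports "HOL-Analysis.Analysis"
begin

(* The maximum and minimum of a real function over a (possibly infinite) set.
   Unlike Sup and Inf these must be attained: if the extremum is not attained, the value
   is unspecified. *)

definition max_over :: "'a set \<Rightarrow> ('a \<Rightarrow> real) \<Rightarrow> real" where
  "max_over S g = (GREATEST v. v \<in> g ` S)"

definition min_over :: "'a set \<Rightarrow> ('a \<Rightarrow> real) \<Rightarrow> real" where
  "min_over S g = (LEAST v. v \<in> g ` S)"

lemma max_over_eqI:
  assumes "x \<in> S" and "\<And>y. y \<in> S \<Longrightarrow> g y \<le> g x"
  shows "max_over S g = g x"
  unfolding max_over_def using assms by (intro Greatest_equality) auto

lemma min_over_eqI:
  assumes "x \<in> S" and "\<And>y. y \<in> S \<Longrightarrow> g x \<le> g y"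
  shows "min_over S g = g x"
  unfolding min_over_def using assms by (intro Least_equality) auto

(* In the following, K is the cell Omega_h itself, not its closure, and h is its
   characteristic size, which is a free parameter not tied to the geometry of K. *)

definition local_grad ::
    "(real ^ 'd) set \<Rightarrow> real \<Rightarrow> (real ^ 'd \<Rightarrow> real) \<Rightarrow> real ^ 'd \<Rightarrow> real" where
  "local_grad K h g x = max_over (closure K) (\<lambda>y. \<bar>g x - g y\<bar> / h)"

definition chi_LGS :: "(real ^ 'd) set \<Rightarrow> real \<Rightarrow> (real ^ 'd \<Rightarrow> real) \<Rightarrow> real" where
  "chi_LGS K h f = h * max_over (closure K) (local_grad K h (\<lambda>x. ln (f x)))"

definition chi_LDR :: "(real ^ 'd) set \<Rightarrow> (real ^ 'd \<Rightarrow> real) \<Rightarrow> real" where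
  "chi_LDR K f = ln (max_over (closure K) f / min_over (closure K) f)"

end

theory Submission
  imports Defs
begin

text \<open>
  Put \<open>g = ln \<circ> f\<close>. For a function that has both a maximizer \<open>p\<close> and a minimizer \<open>q\<close> on the closed
  cell, the largest increment \<open>\<bar>g x - g y\<bar>\<close> over pairs of points is the oscillation \<open>g p - g q\<close>; so
  \<open>h\<close> times the largest local gradient is this oscillation, the factor \<open>h\<close> cancelling the
  denominator in the difference quotient. Since \<open>ln\<close> is increasing, extremizers of \<open>f\<close> are
  extremizers of \<open>ln \<circ> f\<close>, and \<open>ln (f p) - ln (f q) = ln (f p / f q)\<close> is the log-dynamic ratio.
  The extremizers exist because a Lipschitz function is continuous and the closed cell is compact.
\<close>

text \<open>
  Among all values of \<open>g\<close>, the one farthest from \<open>g x\<close> is one of the two extreme values, so \<open>p\<close> or \<open>q\<close>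
  attains the maximum that defines the local gradient at \<open>x\<close>.
\<close>

lemma local_grad_eq_distance_to_extrema:
  assumes "h > 0"
    and p: "p \<in> closure K" "\<And>y. y \<in> closure K \<Longrightarrow> g y \<le> g p"
    and q: "q \<in> closure K" "\<And>y. y \<in> closure K \<Longrightarrow> g q \<le> g y"
    and x: "x \<in> closure K"
  shows "local_grad K h g x = max (g p - g x) (g x - g q) / h"
proof -
  have px: "g x \<le> g p" and qx: "g q \<le> g x"
    using p(2) q(2) x by auto
  have bound: "\<bar>g x - g y\<bar> \<le> max (g p - g x) (g x - g q)" if "y \<in> closure K" for y
    using p(2)[OF that] q(2)[OF that] by linarith
  obtain z where z: "z \<in> closure K" "\<bar>g x - g z\<bar> = max (g p - g x) (g x - g q)"
  proof (cases "g x - g q \<le> g p - g x")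
    case True
    then show ?thesis using that[of p] p(1) px by simp
  next
    case False
    then show ?thesis using that[of q] q(1) qx by simp
  qed
  have "local_grad K h g x = \<bar>g x - g z\<bar> / h"
    unfolding local_grad_def
    using z bound \<open>h > 0\<close> by (intro max_over_eqI) (auto intro!: divide_right_mono)
  then show ?thesis using z(2) by simp
qed

text \<open>
  Both terms of the maximum in the preceding formula are at most \<open>g p - g q\<close>, and at \<open>x = p\<close> the
  second one equals it: the local gradient is largest at a maximizer.
\<close>

lemma max_local_grad_eq_oscillation:
  assumes "h > 0"
    and p: "p \<in> closure K" "\<And>y. y \<in> closure K \<Longrightarrow> g y \<le> g p"
    and q: "q \<in> closure K" "\<And>y. y \<in> closure K \<Longrightarrow> g q \<le> g y"
  shows "max_over (closure K) (local_grad K h g) = (g p - g q) / h"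
proof -
  have grad: "local_grad K h g x = max (g p - g x) (g x - g q) / h" if "x \<in> closure K" for x
    using assms that by (intro local_grad_eq_distance_to_extrema) auto
  have at_p: "local_grad K h g p = (g p - g q) / h"
    using grad[OF p(1)] q(2)[OF p(1)] by simp
  have "local_grad K h g y \<le> local_grad K h g p" if "y \<in> closure K" for y
    unfolding at_p grad[OF that]
    using p(2)[OF that] q(2)[OF that] \<open>h > 0\<close> by (intro divide_right_mono) auto
  then show ?thesis
    using max_over_eqI[OF p(1)] at_p by metis
qed

theorem proposition3p3:
  fixes \<Omega> \<Omega>h :: "(real ^ 'd) set"
    and f :: "real ^ 'd \<Rightarrow> real"
    and h :: real
  assumes "open \<Omega>"
    and "\<exists>L. L-lipschitz_on (closure \<Omega>) f"
    and "\<And>x. x \<in> closure \<Omega> \<Longrightarrow> f x > 0"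
    and "\<Omega>h \<subseteq> \<Omega>"
    and "\<Omega>h \<noteq> {}"
    and "bounded \<Omega>h"
    and "h > 0"
  shows "chi_LGS \<Omega>h h f = chi_LDR \<Omega>h f"
proof -
  let ?K = "closure \<Omega>h"
  have sub: "?K \<subseteq> closure \<Omega>"
    using assms(4) by (rule closure_mono)
  have cont: "continuous_on ?K f"
    using assms(2) sub lipschitz_on_continuous_on continuous_on_subset by metis
  have K: "compact ?K" "?K \<noteq> {}"
    using assms(5,6) by (simp_all add: compact_closure)
  have pos: "f x > 0" if "x \<in> ?K" for x
    using assms(3) sub that by blast
  obtain p where p: "p \<in> ?K" "\<And>y. y \<in> ?K \<Longrightarrow> f y \<le> f p"
    using continuous_attains_sup[OF K cont] by blast
  obtain q where q: "q \<in> ?K" "\<And>y. y \<in> ?K \<Longrightarrow> f q \<le> f y"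
    using continuous_attains_inf[OF K cont] by blast
  have "max_over ?K (local_grad \<Omega>h h (\<lambda>x. ln (f x))) = (ln (f p) - ln (f q)) / h"
    using assms(7) p q pos by (intro max_local_grad_eq_oscillation) auto
  then have "chi_LGS \<Omega>h h f = ln (f p) - ln (f q)"
    unfolding chi_LGS_def using assms(7) by simp
  also have "\<dots> = ln (f p / f q)"
    using pos[OF p(1)] pos[OF q(1)] by (simp add: ln_div)
  also have "\<dots> = chi_LDR \<Omega>h f"
    unfolding chi_LDR_def using max_over_eqI[of p ?K f, OF p] min_over_eqI[of q ?K f, OF q] by simp
  finally show ?thesis .
qed

end
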